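(* Let $A$ be a C$^*$-algebra with cancellation. Suppose that $A$ is contained in the closure (in norm) of the group $M(A)^{-1}$ of invertible elements of the multiplier algebra $M(A)$, and that $K_0(A)^+=D_0(A)$. Then for all $a,b\in A$ and all $g,h\in K_0(A)^+$, \[ s_{g+h}(a+b)\leq s_g(a)+s_h(b). \]
   Context: For a C$^*$-algebra $A$, $P(A)$ denotes the set of projections of $A$, $K_0(A)$ is the usual $K_0$-group with positive cone $K_0(A)^+=\{[p]_0 : p \text{ a projection in } M_n(A) \text{ for some } n\geq 1\}$, and for $g,h\in K_0(A)$ we write $g\leq h$ if $h-g\in K_0(A)^+$. The dimension range is $D_0(A)=\{[p]_0\mid p\in P(A)\}$. $A$ has cancellation if for all projections $p,q$ in $\bigcup_{n\geq1}M_n(A)$, $[p]_0=[q]_0$ if and only if $p$ and $q$ are Murray--von Neumann equivalent. The singular value function of $a\in A$ is the function $s(a)\colon K_0(A)^+\to[0,\infty)$ defined by \[ s_g(a):=\inf\{\|a-ap\| \mid p\in P(A),\ [p]_0\leq g\},\qquad g\in K_0(A)^+. \] *)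

theory Defs
  imports "HOL-Analysis.Analysis"
begin

locale cstar_algebra =
  fixes sc :: "complex \<Rightarrow> 'a::{real_normed_algebra,banach} \<Rightarrow> 'a"
    and st :: "'a \<Rightarrow> 'a"
  assumes sc_of_real: "\<And>r x. sc (complex_of_real r) x = scaleR r x"
    and sc_mult: "\<And>z w x. sc (z * w) x = sc z (sc w x)"
    and sc_add_left: "\<And>z w x. sc (z + w) x = sc z x + sc w x"
    and sc_add_right: "\<And>z x y. sc z (x + y) = sc z x + sc z y"
    and sc_mult_left: "\<And>z x y. sc z (x * y) = sc z x * y"
    and sc_mult_right: "\<And>z x y. sc z (x * y) = x * sc z y"
    and sc_norm: "\<And>z x. norm (sc z x) = cmod z * norm x"
    and st_st: "\<And>x. st (st x) = x"
    and st_add: "\<And>x y. st (x + y) = st x + st y"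
    and st_mult: "\<And>x y. st (x * y) = st y * st x"
    and st_sc: "\<And>z x. st (sc z x) = sc (cnj z) (st x)"
    and cstar_id: "\<And>x. norm (st x * x) = (norm x)\<^sup>2"

definition cproj :: "('a::real_normed_algebra \<Rightarrow> 'a) \<Rightarrow> 'a \<Rightarrow> bool" where
  "cproj st p \<longleftrightarrow> st p = p \<and> p * p = p"

text \<open>The unitization is A \<times> complex, with (a,l)(b,m) = (ab + l b + m a, l m).\<close>
definition umult :: "(complex \<Rightarrow> 'a \<Rightarrow> 'a) \<Rightarrow> ('a::real_normed_algebra \<times> complex)
     \<Rightarrow> ('a \<times> complex) \<Rightarrow> ('a \<times> complex)" where
  "umult sc x y = (fst x * fst y + sc (snd x) (fst y) + sc (snd y) (fst x), snd x * snd y)"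

definition ustar :: "('a \<Rightarrow> 'a) \<Rightarrow> ('a \<times> complex) \<Rightarrow> ('a \<times> complex)" where
  "ustar st x = (st (fst x), cnj (snd x))"

text \<open>Matrices over the unitization are modelled as infinite matrices
(nat \<Rightarrow> nat \<Rightarrow> entry); an element of M_n is one supported in the n\<times>n corner.
Matrices with entries in A are those with all scalar parts 0.\<close>
type_synonym 'a umat = "nat \<Rightarrow> nat \<Rightarrow> 'a \<times> complex"

definition supp_in :: "nat \<Rightarrow> ('a::zero) umat \<Rightarrow> bool" where
  "supp_in n M \<longleftrightarrow> (\<forall>i j. n \<le> i \<or> n \<le> j \<longrightarrow> M i j = 0)"

definition in_A :: "'a umat \<Rightarrow> bool" where
  "in_A M \<longleftrightarrow> (\<forall>i j. snd (M i j) = 0)"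

definition umm :: "(complex \<Rightarrow> 'a \<Rightarrow> 'a) \<Rightarrow> nat \<Rightarrow> ('a::real_normed_algebra) umat \<Rightarrow> 'a umat \<Rightarrow> 'a umat" where
  "umm sc N M P = (\<lambda>i j. \<Sum>k<N. umult sc (M i k) (P k j))"

definition ustar_m :: "('a \<Rightarrow> 'a) \<Rightarrow> 'a umat \<Rightarrow> 'a umat" where
  "ustar_m st M = (\<lambda>i j. ustar st (M j i))"

definition uproj :: "(complex \<Rightarrow> 'a \<Rightarrow> 'a) \<Rightarrow> ('a \<Rightarrow> 'a) \<Rightarrow> nat \<Rightarrow> ('a::real_normed_algebra) umat \<Rightarrow> bool" where
  "uproj sc st n p \<longleftrightarrow> supp_in n p \<and> ustar_m st p = p \<and> umm sc n p p = p"

definition proj_A :: "(complex \<Rightarrow> 'a \<Rightarrow> 'a) \<Rightarrow> ('a \<Rightarrow> 'a) \<Rightarrow> nat \<Rightarrow> ('a::real_normed_algebra) umat \<Rightarrow> bool" where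
  "proj_A sc st n p \<longleftrightarrow> uproj sc st n p \<and> in_A p"

text \<open>Murray--von Neumann equivalence ~0 of projections in M_infty (partial isometry v
of any (rectangular) finite size, embedded in a square corner), over the unitization
and over A.\<close>
definition mvn :: "(complex \<Rightarrow> 'a \<Rightarrow> 'a) \<Rightarrow> ('a \<Rightarrow> 'a) \<Rightarrow> ('a::real_normed_algebra) umat \<Rightarrow> 'a umat \<Rightarrow> bool" where
  "mvn sc st p q \<longleftrightarrow> (\<exists>N v. supp_in N v \<and> supp_in N p \<and> supp_in N q \<and>
      umm sc N (ustar_m st v) v = p \<and> umm sc N v (ustar_m st v) = q)"

definition mvn_A :: "(complex \<Rightarrow> 'a \<Rightarrow> 'a) \<Rightarrow> ('a \<Rightarrow> 'a) \<Rightarrow> ('a::real_normed_algebra) umat \<Rightarrow> 'a umat \<Rightarrow> bool" where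
  "mvn_A sc st p q \<longleftrightarrow> (\<exists>N v. in_A v \<and> supp_in N v \<and> supp_in N p \<and> supp_in N q \<and>
      umm sc N (ustar_m st v) v = p \<and> umm sc N v (ustar_m st v) = q)"

definition dsum :: "nat \<Rightarrow> ('a::zero) umat \<Rightarrow> 'a umat \<Rightarrow> 'a umat" where
  "dsum n p q = (\<lambda>i j. if i < n \<and> j < n then p i j
                       else if n \<le> i \<and> n \<le> j then q (i - n) (j - n) else 0)"

text \<open>Classes [p]_0 are represented by sized projections (n,p).  For projections p,q over A,
[p]_0 = [q]_0 in K_0(A) means equality of their classes in the Grothendieck group
K_0 of the unitization (K_0(A) being the kernel of K_0(unitization) \<rightarrow> K_0(C)), i.e.
p \<oplus> r ~0 q \<oplus> r for some projection r over the unitization.\<close>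
definition k0_eq :: "(complex \<Rightarrow> 'a \<Rightarrow> 'a) \<Rightarrow> ('a \<Rightarrow> 'a) \<Rightarrow> nat \<times> ('a::real_normed_algebra) umat
     \<Rightarrow> nat \<times> 'a umat \<Rightarrow> bool" where
  "k0_eq sc st x y \<longleftrightarrow> (\<exists>k r. uproj sc st k r \<and>
      mvn sc st (dsum (fst x) (snd x) r) (dsum (fst y) (snd y) r))"

definition k0_add :: "nat \<times> ('a::zero) umat \<Rightarrow> nat \<times> 'a umat \<Rightarrow> nat \<times> 'a umat" where
  "k0_add x y = (fst x + fst y, dsum (fst x) (snd x) (snd y))"

text \<open>[p]_0 \<le> [q]_0 iff [q]_0 - [p]_0 \<in> K_0(A)^+, i.e. [q]_0 = [p]_0 + [e]_0 for some
projection e over A.\<close>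
definition k0_le :: "(complex \<Rightarrow> 'a \<Rightarrow> 'a) \<Rightarrow> ('a \<Rightarrow> 'a) \<Rightarrow> nat \<times> ('a::real_normed_algebra) umat
     \<Rightarrow> nat \<times> 'a umat \<Rightarrow> bool" where
  "k0_le sc st x y \<longleftrightarrow> (\<exists>k e. proj_A sc st k e \<and> k0_eq sc st y (k0_add x (k, e)))"

definition single :: "'a::zero \<Rightarrow> 'a umat" where
  "single a = (\<lambda>i j. if i = 0 \<and> j = 0 then (a, 0) else 0)"

definition sval :: "(complex \<Rightarrow> 'a \<Rightarrow> 'a) \<Rightarrow> ('a \<Rightarrow> 'a) \<Rightarrow> nat \<times> ('a::real_normed_algebra) umat
     \<Rightarrow> 'a \<Rightarrow> real" where
  "sval sc st g a = Inf {norm (a - a * p) | p. cproj st p \<and> k0_le sc st (1, single p) g}"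

definition double_centralizer :: "('a::real_normed_algebra \<Rightarrow> 'a) \<Rightarrow> ('a \<Rightarrow> 'a) \<Rightarrow> bool" where
  "double_centralizer L R \<longleftrightarrow>
     (\<forall>a b. L (a * b) = L a * b \<and> R (a * b) = a * R b \<and> R a * b = a * L b)"

text \<open>Invertible multipliers: product (L,R)(L',R') = (L o L', R' o R), unit (id,id).\<close>
definition mult_invertible :: "('a::real_normed_algebra \<Rightarrow> 'a) \<Rightarrow> ('a \<Rightarrow> 'a) \<Rightarrow> bool" where
  "mult_invertible L R \<longleftrightarrow> double_centralizer L R \<and>
     (\<exists>L' R'. double_centralizer L' R' \<and> L \<circ> L' = id \<and> L' \<circ> L = id \<and>
              R' \<circ> R = id \<and> R \<circ> R' = id)"

text \<open>A is contained in the norm closure of M(A)^{-1}; A embeds as (left mult, right mult)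
and the norm of a multiplier (L,R) is the operator norm of L.\<close>
definition in_closure_invertible_multipliers :: "'a::real_normed_algebra itself \<Rightarrow> bool" where
  "in_closure_invertible_multipliers _ \<longleftrightarrow>
     (\<forall>(a::'a) \<epsilon>. \<epsilon> > 0 \<longrightarrow> (\<exists>L R. mult_invertible L R \<and> onorm (\<lambda>b. a * b - L b) < \<epsilon>))"

end

theory Submission
  imports Defs
begin

text \<open>
Let p and q be projections with [p] \<le> g and [q] \<le> h such that a p and b q nearly realize the two
singular values. Since K_0(A)^+ = D_0(A) and A has cancellation, p \<oplus> q is equivalent to a
projection f of A, and a partial isometry implementing this equivalence factors a p + b q as s f t
with s, t in A. Approximate t by an invertible multiplier T. The right support projection e of f T
lies in A and is equivalent to f, so [e] = [p] + [q] \<le> g + h, while s f T (1 - e) = 0 and hence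
(a p + b q)(1 - e) is small.

The polar decomposition of w = f T needs no spectral theory. Square roots come from an iteration,
and a mean ergodic argument inverts w w* in the corner of f. With v = |w w*|^(-1/2) w, the element
v v* is a symmetry, and it is f because x x* cannot be minus a nonzero projection.
\<close>

section \<open>Square roots in Banach algebras\<close>

text \<open>The iteration converges to the solution 1 - sqrt(1 - x) of 2y - y^2 = x; its increments
are dominated by those of the scalar iteration for x = 1.\<close>
primrec sqrt_iter :: "'a::real_normed_algebra \<Rightarrow> nat \<Rightarrow> 'a" where
  "sqrt_iter x 0 = 0"
| "sqrt_iter x (Suc n) = (1/2) *\<^sub>R (x + sqrt_iter x n * sqrt_iter x n)"

definition one_minus_sqrt :: "'a::real_normed_algebra \<Rightarrow> 'a" where
  "one_minus_sqrt x = lim (sqrt_iter x)"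

lemma sqrt_iter_one_bounds: "0 \<le> sqrt_iter (1::real) n \<and> sqrt_iter (1::real) n \<le> 1"
  by (induction n) (auto intro!: mult_le_one)

lemma incseq_sqrt_iter_one: "incseq (sqrt_iter (1::real))"
proof (rule incseq_SucI)
  show "sqrt_iter (1::real) n \<le> sqrt_iter 1 (Suc n)" for n
    using zero_le_power2[of "sqrt_iter (1::real) n - 1"]
    by (simp add: power2_eq_square algebra_simps)
qed

lemma norm_sqrt_iter_le:
  assumes "norm x \<le> 1"
  shows "norm (sqrt_iter x n) \<le> sqrt_iter 1 n"
proof (induction n)
  case (Suc n)
  have "norm (x + sqrt_iter x n * sqrt_iter x n) \<le> 1 + sqrt_iter 1 n * sqrt_iter 1 n"
    by (intro order_trans[OF norm_triangle_ineq] add_mono assms order_trans[OF norm_mult_ineq]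
        mult_mono Suc) (use sqrt_iter_one_bounds in auto)
  then show ?case by simp
qed simp

lemma norm_sqrt_iter_Suc_diff_le:
  assumes "norm x \<le> 1"
  shows "norm (sqrt_iter x (Suc n) - sqrt_iter x n) \<le> sqrt_iter 1 (Suc n) - sqrt_iter 1 n"
proof (induction n)
  case 0
  show ?case using assms by simp
next
  case (Suc n)
  define y y' where "y = sqrt_iter x n" and "y' = sqrt_iter x (Suc n)"
  define r r' :: real where "r = sqrt_iter 1 n" and "r' = sqrt_iter 1 (Suc n)"
  have "sqrt_iter x (Suc (Suc n)) - y' = (1/2) *\<^sub>R ((x + y' * y') - (x + y * y))"
    by (simp add: y_def y'_def scaleR_right_distrib scaleR_diff_right)
  also have "\<dots> = (1/2) *\<^sub>R ((y' - y) * y' + y * (y' - y))"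
    by (simp add: algebra_simps)
  finally have diff: "sqrt_iter x (Suc (Suc n)) - y' = \<dots>" .
  have "norm ((y' - y) * y' + y * (y' - y)) \<le> (r' - r) * r' + r * (r' - r)"
    using Suc sqrt_iter_one_bounds incseq_SucD[OF incseq_sqrt_iter_one] norm_sqrt_iter_le[OF assms]
    unfolding y_def y'_def r_def r'_def
    by (intro order_trans[OF norm_triangle_ineq] add_mono order_trans[OF norm_mult_ineq] mult_mono)
      (auto simp del: sqrt_iter.simps(2))
  also have "\<dots> = 2 * (sqrt_iter 1 (Suc (Suc n)) - r')"
    by (simp add: r_def r'_def algebra_simps)
  finally show ?case
    using diff by (simp add: y'_def r'_def del: sqrt_iter.simps(2))
qed

lemma sqrt_iter_LIMSEQ:
  fixes x :: "'a::{real_normed_algebra,banach}"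
  assumes "norm x \<le> 1"
  shows "sqrt_iter x \<longlonglongrightarrow> one_minus_sqrt x"
proof -
  have "convergent (sqrt_iter (1::real))"
    using sqrt_iter_one_bounds incseq_sqrt_iter_one
    by (intro Bseq_mono_convergent[OF BseqI'[where K = 1]]) (auto dest: incseqD)
  then have "summable (\<lambda>n. sqrt_iter (1::real) (Suc n) - sqrt_iter 1 n)"
    unfolding convergent_def by (blast intro: telescope_summable)
  then have "summable (\<lambda>n. sqrt_iter x (Suc n) - sqrt_iter x n)"
    by (rule summable_comparison_test'[where N = 0]) (rule norm_sqrt_iter_Suc_diff_le[OF assms])
  then have "convergent (\<lambda>n. \<Sum>k<n. sqrt_iter x (Suc k) - sqrt_iter x k)"
    by (simp only: summable_iff_convergent)
  then have "convergent (sqrt_iter x)"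
    by (simp only: sum_lessThan_telescope sqrt_iter.simps(1) diff_zero)
  then show ?thesis by (simp add: one_minus_sqrt_def convergent_LIMSEQ_iff)
qed

lemma one_minus_sqrt_eq:
  fixes x :: "'a::{real_normed_algebra,banach}"
  assumes "norm x \<le> 1"
  shows "2 *\<^sub>R one_minus_sqrt x - one_minus_sqrt x * one_minus_sqrt x = x"
proof -
  let ?y = "one_minus_sqrt x"
  note lim = sqrt_iter_LIMSEQ[OF assms]
  have "(\<lambda>n. sqrt_iter x (Suc n)) \<longlonglongrightarrow> (1/2) *\<^sub>R (x + ?y * ?y)"
    unfolding sqrt_iter.simps by (intro tendsto_intros lim)
  then have "?y = (1/2) *\<^sub>R (x + ?y * ?y)"
    using LIMSEQ_Suc[OF lim] LIMSEQ_unique by blast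
  from arg_cong[OF this, of "scaleR 2"] show ?thesis by simp
qed

lemma norm_one_minus_sqrt_le_1:
  fixes x :: "'a::{real_normed_algebra,banach}"
  assumes "norm x \<le> 1"
  shows "norm (one_minus_sqrt x) \<le> 1"
  using norm_sqrt_iter_le[OF assms] sqrt_iter_one_bounds
  by (intro Lim_bounded[OF tendsto_norm[OF sqrt_iter_LIMSEQ[OF assms]], of 0])
    (blast intro: order_trans)

lemma one_minus_sqrt_closed_induct:
  fixes x :: "'a::{real_normed_algebra,banach}"
  assumes "norm x \<le> 1" "closed {y. P y}" "P 0" "\<And>y. P y \<Longrightarrow> P ((1/2) *\<^sub>R (x + y * y))"
  shows "P (one_minus_sqrt x)"
proof -
  have "P (sqrt_iter x n)" for n by (induction n) (simp_all add: assms)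
  then show ?thesis
    using closed_sequentially[OF assms(2) _ sqrt_iter_LIMSEQ[OF assms(1)]] by simp
qed

lemma one_minus_sqrt_commute:
  fixes x :: "'a::{real_normed_algebra,banach}"
  assumes "norm x \<le> 1" "c * x = x * c"
  shows "c * one_minus_sqrt x = one_minus_sqrt x * c"
  using assms(1)
proof (rule one_minus_sqrt_closed_induct)
  show "closed {y. c * y = y * c}" by (intro closed_Collect_eq continuous_intros)
  show "c * ((1/2) *\<^sub>R (x + y * y)) = (1/2) *\<^sub>R (x + y * y) * c" if "c * y = y * c" for y
  proof -
    have "c * (y * y) = y * y * c" using that by (metis mult.assoc)
    then show ?thesis by (simp add: assms(2) algebra_simps)
  qed
qed simp

lemma mult_one_minus_sqrt:
  fixes x :: "'a::{real_normed_algebra,banach}"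
  assumes "norm x \<le> 1" "f * x = x"
  shows "f * one_minus_sqrt x = one_minus_sqrt x"
  using assms(1)
proof (rule one_minus_sqrt_closed_induct)
  show "closed {y. f * y = y}" by (intro closed_Collect_eq continuous_intros)
qed (simp_all add: assms(2) algebra_simps flip: mult.assoc)

lemma one_minus_sqrt_mult:
  fixes x :: "'a::{real_normed_algebra,banach}"
  assumes "norm x \<le> 1" "x * f = x"
  shows "one_minus_sqrt x * f = one_minus_sqrt x"
  using assms(1)
proof (rule one_minus_sqrt_closed_induct)
  show "closed {y. y * f = y}" by (intro closed_Collect_eq continuous_intros)
qed (simp_all add: assms(2) algebra_simps)

definition corner_sqrt :: "'a::real_normed_algebra \<Rightarrow> 'a \<Rightarrow> 'a" where
  "corner_sqrt f x = f - one_minus_sqrt (f - x)"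

lemma
  fixes x :: "'a::{real_normed_algebra,banach}"
  assumes f: "f * f = f" and x: "f * x = x" "x * f = x" "norm (f - x) \<le> 1"
  shows mult_corner_sqrt: "f * corner_sqrt f x = corner_sqrt f x"
    and corner_sqrt_mult: "corner_sqrt f x * f = corner_sqrt f x"
    and corner_sqrt_square: "corner_sqrt f x * corner_sqrt f x = x"
    and norm_minus_corner_sqrt_le_1: "norm (f - corner_sqrt f x) \<le> 1"
proof -
  let ?y = "one_minus_sqrt (f - x)"
  have y: "f * ?y = ?y" "?y * f = ?y"
    using x f by (simp_all add: mult_one_minus_sqrt one_minus_sqrt_mult algebra_simps)
  then show "f * corner_sqrt f x = corner_sqrt f x" "corner_sqrt f x * f = corner_sqrt f x"
    by (simp_all add: corner_sqrt_def f algebra_simps)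
  have "corner_sqrt f x * corner_sqrt f x = f - (2 *\<^sub>R ?y - ?y * ?y)"
    by (simp add: corner_sqrt_def f y algebra_simps scaleR_2)
  then show "corner_sqrt f x * corner_sqrt f x = x"
    by (simp add: one_minus_sqrt_eq x)
  show "norm (f - corner_sqrt f x) \<le> 1"
    by (simp add: corner_sqrt_def norm_one_minus_sqrt_le_1 x)
qed

lemma corner_sqrt_commute:
  fixes x :: "'a::{real_normed_algebra,banach}"
  assumes "norm (f - x) \<le> 1" "c * f = f * c" "c * x = x * c"
  shows "c * corner_sqrt f x = corner_sqrt f x * c"
  using assms one_minus_sqrt_commute[of "f - x" c] by (simp add: corner_sqrt_def algebra_simps)

section \<open>Inverses in corners of Banach algebras\<close>

lemma corner_right_inverse_near_unit:
  fixes f u :: "'a::{real_normed_algebra,banach}"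
  assumes f: "f * f = f" and u: "f * u = u" "norm u < 1"
  obtains z where "f * z = z" "(f - u) * z = f"
proof -
  have "\<exists>!z\<in>UNIV. f + u * z = z"
    by (rule Banach_fix[where c = "norm u"])
      (auto simp: complete_UNIV u dist_norm norm_mult_ineq simp flip: right_diff_distrib)
  then obtain z where z: "f + u * z = z" by blast
  have "f * (f + u * z) = f + u * z"
    by (simp add: f u algebra_simps flip: mult.assoc)
  then have "f * z = z" by (simp add: z)
  moreover from this have "(f - u) * z = f" using z by (simp add: algebra_simps)
  ultimately show thesis by (rule that)
qed

text \<open>Mean ergodic argument: (f - x) S = f - x^n for the partial sums S of the geometric series,
so they are bounded, and the average of n of them inverts f - x up to an error S / n.\<close>
lemma geometric_double_sum:
  fixes f x :: "'a::{real_normed_algebra,banach}"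
  assumes f: "f * f = f" "norm f \<le> 1" and x: "f * x = x" "norm x \<le> 1"
    and "\<delta> > 0" and below: "\<And>b. f * b = b \<Longrightarrow> \<delta> * norm b \<le> norm (b - x * b)"
  obtains S T where "f * S = S" "f * T = T" "norm S \<le> 2 / \<delta>" "T - x * T = real n *\<^sub>R f - S"
proof -
  define P where "P k = ((*) x ^^ k) f" for k
  define S where "S k = (\<Sum>j<k. P j)" for k
  define T where "T = (\<Sum>j<n. S j)"
  have fP: "f * P k = P k" for k by (induction k) (simp_all add: P_def f x flip: mult.assoc)
  have fS: "f * S k = S k" for k by (simp add: S_def sum_distrib_left fP)
  then have fT: "f * T = T" by (simp add: T_def sum_distrib_left)
  have "norm (P k) \<le> 1" for k
    using f x by (induction k) (auto simp: P_def intro!: order_trans[OF norm_mult_ineq] mult_le_one)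
  then have dist_P: "norm (f - P k) \<le> 2" for k
    using norm_triangle_ineq4[of f "P k"] f(2) by (metis add_mono one_add_one order_trans)
  have telescope_S: "S k - x * S k = f - P k" for k
    using sum_lessThan_telescope'[of P k]
    by (simp add: S_def P_def sum_distrib_left flip: sum_subtractf)
  have norm_S: "norm (S n) \<le> 2 / \<delta>"
    using below[OF fS[of n]] dist_P[of n] \<open>\<delta> > 0\<close> by (simp add: telescope_S field_simps)
  have "T - x * T = (\<Sum>j<n. f - P j)"
    by (simp add: T_def telescope_S sum_distrib_left flip: sum_subtractf)
  also have "\<dots> = real n *\<^sub>R f - S n" by (simp add: S_def sum_subtractf sum_constant_scaleR)
  finally show thesis using fS fT norm_S by (intro that)
qed

lemma corner_right_inverse_if_bounded_below:
  fixes f x :: "'a::{real_normed_algebra,banach}"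
  assumes f: "f * f = f" "norm f \<le> 1" and x: "f * x = x" "norm x \<le> 1"
    and "\<delta> > 0" and "\<And>b. f * b = b \<Longrightarrow> \<delta> * norm b \<le> norm (b - x * b)"
  obtains z where "f * z = z" "(f - x) * z = f"
proof -
  obtain n where n: "2 / \<delta> < real n" using reals_Archimedean2 by blast
  then have "n > 0" using \<open>\<delta> > 0\<close> by (cases n) (simp_all add: field_simps)
  obtain S T where S: "f * S = S" "norm S \<le> 2 / \<delta>"
    and T: "f * T = T" "T - x * T = real n *\<^sub>R f - S"
    using geometric_double_sum[OF assms, of n] by blast
  have "norm ((1 / real n) *\<^sub>R S) < 1" using S(2) n \<open>n > 0\<close> by simp
  moreover have "f * (1 / real n) *\<^sub>R S = (1 / real n) *\<^sub>R S" by (simp add: S)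
  ultimately obtain z where z: "f * z = z" "(f - (1 / real n) *\<^sub>R S) * z = f"
    using corner_right_inverse_near_unit[OF f(1)] by metis
  have "(f - x) * T = real n *\<^sub>R (f - (1 / real n) *\<^sub>R S)"
    using \<open>n > 0\<close> T by (simp add: algebra_simps)
  then have "(f - x) * ((1 / real n) *\<^sub>R (T * z)) = f"
    using \<open>n > 0\<close> by (simp add: z flip: mult.assoc)
  moreover have "f * ((1 / real n) *\<^sub>R (T * z)) = (1 / real n) *\<^sub>R (T * z)"
    by (simp add: T flip: mult.assoc)
  ultimately show thesis using that by blast
qed

section \<open>Uniform boundedness\<close>

lemma closed_cover_interior_nonempty:
  fixes V :: "nat \<Rightarrow> 'a::complete_space set"
  assumes "\<And>k. closed (V k)" "(\<Union>k. V k) = UNIV"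
  obtains k where "interior (V k) \<noteq> {}"
proof (rule ccontr)
  assume "\<not> thesis"
  then have "interior (V k) = {}" for k using that by blast
  then have "euclidean interior_of \<Union>(range V) = {}"
    by (intro Baire_category_alt) (auto simp: completely_metrizable_space_euclidean assms(1))
  then show False using assms(2) by simp
qed

lemma linear_norm_le_if_bounded_on_ball:
  fixes F :: "'a::real_normed_vector \<Rightarrow> 'b::real_normed_vector"
  assumes F: "linear F" and "e > 0" and bound: "\<And>b. norm b < e \<Longrightarrow> norm (F b) \<le> K"
  shows "norm (F x) \<le> 2 * K / e * norm x"
proof (cases "x = 0")
  case False
  have "norm (F ((e / (2 * norm x)) *\<^sub>R x)) \<le> K"
    using False \<open>e > 0\<close> by (intro bound) simp
  then show ?thesis
    using False \<open>e > 0\<close> by (simp add: linear_scale[OF F] field_simps)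
qed (simp add: linear_0[OF F])

lemma uniform_boundedness:
  fixes F :: "'i \<Rightarrow> 'a::banach \<Rightarrow> 'b::real_normed_vector"
  assumes F: "\<And>i. i \<in> I \<Longrightarrow> bounded_linear (F i)"
    and pointwise: "\<And>x. \<exists>K. \<forall>i\<in>I. norm (F i x) \<le> K"
  obtains K where "\<And>i x. i \<in> I \<Longrightarrow> norm (F i x) \<le> K * norm x"
proof -
  define V where "V k = {x. \<forall>i\<in>I. norm (F i x) \<le> real k}" for k
  have "closed (V k)" for k
  proof -
    have "V k = (\<Inter>i\<in>I. {x. norm (F i x) \<le> real k})" by (auto simp: V_def)
    then show ?thesis
      using F by (auto intro!: closed_INT closed_Collect_le continuous_intros
          simp: linear_continuous_on)
  qed
  moreover have "(\<Union>k. V k) = UNIV"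
    using pointwise real_arch_simple by (fastforce simp: V_def intro: order_trans)
  ultimately obtain k where "interior (V k) \<noteq> {}" by (rule closed_cover_interior_nonempty)
  then obtain c e where ball: "e > 0" "ball c e \<subseteq> V k"
    by (metis ex_in_conv mem_interior)
  have "norm (F i b) \<le> 2 * real k" if i: "i \<in> I" and b: "norm b < e" for i b
  proof -
    have "c + b \<in> V k" "c \<in> V k" using ball b by (auto simp: dist_norm subset_iff)
    then have "norm (F i (c + b)) \<le> real k" "norm (F i c) \<le> real k"
      using i by (auto simp: V_def)
    then show ?thesis
      using norm_triangle_ineq4[of "F i (c + b)" "F i c"]
      by (simp add: linear_simps(1)[OF F[OF i]])
  qed
  then have "norm (F i x) \<le> 2 * (2 * real k) / e * norm x" if "i \<in> I" for i x
    using that F ball(1) by (intro linear_norm_le_if_bounded_on_ball bounded_linear.linear)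
  then show thesis by (rule that)
qed

context cstar_algebra
begin

section \<open>Involution and projections\<close>

lemma st_scaleR: "st (r *\<^sub>R x) = r *\<^sub>R st x"
  using st_sc[of "complex_of_real r" x] by (simp add: sc_of_real)

lemma norm_st: "norm (st x) = norm x"
proof -
  have st_0: "st 0 = 0" using st_scaleR[of 0 0] by simp
  have norm_le: "norm x \<le> norm (st x)" for x
  proof (cases "x = 0")
    case False
    have "norm x * norm x \<le> norm (st x) * norm x"
      using norm_mult_ineq[of "st x" x] by (simp add: cstar_id power2_eq_square)
    with False show ?thesis by simp
  qed (simp add: st_0)
  show ?thesis using norm_le[of x] norm_le[of "st x"] by (simp add: st_st)
qed

sublocale st: bounded_linear st
  by (rule bounded_linear_intro[where K = 1]) (simp_all add: st_add st_scaleR norm_st)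

lemmas st_simps = st_add st.diff st.neg st.zero st_scaleR st_mult st_st

lemma norm_mult_st: "norm (x * st x) = (norm x)\<^sup>2"
  using cstar_id[of "st x"] by (simp add: st_st norm_st)

lemma mult_st_eq_0: "x * st x = 0 \<Longrightarrow> x = 0"
  using norm_mult_st[of x] by simp

lemma eq_if_left_mult_eq:
  fixes x y :: 'a
  assumes "\<And>a. a * x = a * y"
  shows "x = y"
proof -
  have "norm (st (x - y) * (x - y)) = 0"
    using assms[of "st (x - y)"] by (simp add: algebra_simps)
  then show ?thesis by (simp add: cstar_id)
qed

lemma norm_le_if_mult_unit_ball_le:
  fixes x :: 'a
  assumes "\<And>b. norm b \<le> 1 \<Longrightarrow> norm (x * b) \<le> K"
  shows "norm x \<le> K"
proof (cases "x = 0")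
  case True
  then show ?thesis using assms[of 0] by simp
next
  case False
  have "norm (x * ((1 / norm x) *\<^sub>R st x)) \<le> K"
    using False by (intro assms) (simp add: norm_st)
  then show ?thesis using False by (simp add: norm_mult_st power2_eq_square)
qed

lemma cproj_0: "cproj st 0"
  by (simp add: cproj_def st.zero)

lemma st_mult_cproj: "cproj st f \<Longrightarrow> f * x = x \<Longrightarrow> st x * f = st x"
  by (metis cproj_def st_mult)

lemma norm_cproj_le_1:
  assumes "cproj st f"
  shows "norm f \<le> 1"
proof (cases "f = 0")
  case False
  have "norm f * norm f = norm f"
    using assms cstar_id[of f] by (simp add: cproj_def power2_eq_square)
  with False show ?thesis by simp
qed simp

lemma norm_minus_mult_cproj_le:
  assumes "cproj st e"
  shows "norm (x - x * e) \<le> norm x"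
proof (cases "x - x * e = 0")
  case False
  have e: "st e = e" "\<And>x. x * e * e = x * e"
    using assms by (auto simp: cproj_def mult.assoc)
  have "(x - x * e) * st (x - x * e) = (x - x * e) * st x"
    by (simp add: st_simps e algebra_simps flip: mult.assoc)
  then have "norm (x - x * e) * norm (x - x * e) \<le> norm (x - x * e) * norm x"
    using norm_mult_st[of "x - x * e"] norm_mult_ineq[of "x - x * e" "st x"]
    by (simp add: norm_st power2_eq_square)
  with False show ?thesis by simp
qed simp

lemma norm_minus_mult_cproj_le_dist:
  assumes "cproj st e" "y * e = y"
  shows "norm (x - x * e) \<le> norm (x - y)"
  using norm_minus_mult_cproj_le[OF assms(1), of "x - y"] assms(2) by (simp add: algebra_simps)

lemma st_one_minus_sqrt:
  assumes "norm x \<le> 1" "st x = x"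
  shows "st (one_minus_sqrt x) = one_minus_sqrt x"
  using assms(1)
proof (rule one_minus_sqrt_closed_induct)
  show "closed {y. st y = y}"
    by (intro closed_Collect_eq st.continuous_on continuous_intros)
qed (simp_all add: st_simps assms(2))

lemma st_corner_sqrt:
  assumes "norm (f - x) \<le> 1" "st f = f" "st x = x"
  shows "st (corner_sqrt f x) = corner_sqrt f x"
  using assms by (simp add: corner_sqrt_def st_simps st_one_minus_sqrt)

section \<open>A norm criterion for positivity\<close>

sublocale sc: bounded_linear "sc z" for z
proof (rule bounded_linear_intro[where K = "cmod z"])
  show "sc z (r *\<^sub>R x) = r *\<^sub>R sc z x" for r x
    by (metis sc_of_real sc_mult mult.commute)
qed (simp_all add: sc_add_right sc_norm mult.commute)

lemma sc_i_sc_i: "sc \<i> (sc \<i> x) = - x"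
  using sc_mult[of \<i> \<i> x] sc_of_real[of "-1" x] by simp

lemma st_sc_i: "st (sc \<i> x) = - sc \<i> (st x)"
  using sc_mult[of "-1" \<i> "st x"] sc_of_real[of "-1" "sc \<i> (st x)"] by (simp add: st_sc)

lemmas sc_i_simps = sc_i_sc_i st_sc_i sc.add sc.diff sc.neg
  sc_mult_left[symmetric] sc_mult_right[symmetric]

text \<open>With c = sqrt(1 - h^2) the multipliers h + ic and h - ic are unitary, so c is a contraction.\<close>
lemma norm_minus_square_mult_le:
  assumes h: "st h = h" "norm h \<le> 1"
  shows "norm (b - h * h * b) \<le> norm b"
proof -
  define y where "y = one_minus_sqrt (h * h)"
  have norm_hh: "norm (h * h) \<le> 1"
    using norm_mult_st[of h] h by (simp add: power_le_one)
  have y: "st y = y" "2 *\<^sub>R y - y * y = h * h" "h * y = y * h"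
    using norm_hh by (simp_all add: y_def st_one_minus_sqrt st_simps h one_minus_sqrt_eq
        one_minus_sqrt_commute mult.assoc)
  have hh: "h * (h * b) = y * b + y * b - y * (y * b)" for b
    using arg_cong[OF y(2), of "\<lambda>u. u * b"] by (simp add: algebra_simps scaleR_2)
  have hy: "h * (y * b) = y * (h * b)" for b by (metis y(3) mult.assoc)
  have contraction: "norm (b - y * b) \<le> norm b" for b
  proof -
    define d where "d = b - y * b"
    define U V where "U = h * b + sc \<i> d" and "V = h * b - sc \<i> d"
    have "st U * U = st b * b" "st V * V = st b * b"
      by (simp_all add: U_def V_def d_def st_simps sc_i_simps algebra_simps h y hh hy)
    then have "norm U = norm b" "norm V = norm b"
      using cstar_id[of U] cstar_id[of V] cstar_id[of b] by simp_all
    moreover have "norm (U - V) = 2 * norm d"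
      by (simp add: U_def V_def sc_norm flip: scaleR_2)
    ultimately have "2 * norm d \<le> norm b + norm b"
      using norm_triangle_ineq4[of U V] by simp
    then show ?thesis by (simp add: d_def)
  qed
  have "b - h * h * b = (b - y * b) - y * (b - y * b)"
    by (simp add: algebra_simps hh)
  then show ?thesis using contraction[of b] contraction[of "b - y * b"] by (metis order_trans)
qed

text \<open>For self-adjoint x this says that x is positive, but it is visibly closed under addition
and makes no reference to a unit.\<close>
definition norm_positive :: "'a \<Rightarrow> bool" where
  "norm_positive x \<longleftrightarrow> (\<exists>M\<ge>0. \<forall>b. norm (M *\<^sub>R b - x * b) \<le> M * norm b)"

lemma norm_positive_add:
  assumes "norm_positive x" "norm_positive y"
  shows "norm_positive (x + y)"
proof -
  obtain M N where M: "M \<ge> 0" "\<And>b. norm (M *\<^sub>R b - x * b) \<le> M * norm b"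
    and N: "N \<ge> 0" "\<And>b. norm (N *\<^sub>R b - y * b) \<le> N * norm b"
    using assms by (auto simp: norm_positive_def)
  have "norm ((M + N) *\<^sub>R b - (x + y) * b) \<le> (M + N) * norm b" for b
    using norm_triangle_mono[OF M(2)[of b] N(2)[of b]] by (simp add: algebra_simps)
  then show ?thesis unfolding norm_positive_def using M N by (intro exI[of _ "M + N"]) auto
qed

lemma selfadj_scaled_contraction:
  assumes "st h = h"
  obtains N k where "N > 0" "h = N *\<^sub>R k" "st k = k" "norm k \<le> 1"
proof
  have N: "norm h + 1 > 0" by (simp add: add_nonneg_pos)
  then show "norm h + 1 > 0" "h = (norm h + 1) *\<^sub>R (1 / (norm h + 1)) *\<^sub>R h" by simp_all
  show "st ((1 / (norm h + 1)) *\<^sub>R h) = (1 / (norm h + 1)) *\<^sub>R h"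
    by (simp add: st_scaleR assms)
  show "norm ((1 / (norm h + 1)) *\<^sub>R h) \<le> 1" using N by simp
qed

lemma norm_positive_square:
  assumes "st h = h"
  shows "norm_positive (h * h)"
proof -
  obtain N k where k: "st k = k" "norm k \<le> 1" "h = N *\<^sub>R k"
    using selfadj_scaled_contraction[OF assms] .
  have "norm (N\<^sup>2 *\<^sub>R b - h * h * b) \<le> N\<^sup>2 * norm b" for b
  proof -
    have "N\<^sup>2 *\<^sub>R b - h * h * b = N\<^sup>2 *\<^sub>R (b - k * k * b)"
      by (simp add: k(3) power2_eq_square scaleR_diff_right)
    then show ?thesis
      using norm_minus_square_mult_le[OF k(1,2), of b] by (simp add: mult_left_mono)
  qed
  then show ?thesis unfolding norm_positive_def by (intro exI[of _ "N\<^sup>2"]) auto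
qed

text \<open>Writing x = a + ib with self-adjoint a and b gives x x* + x* x = 2(a^2 + b^2).\<close>
lemma norm_positive_mult_st_add_st_mult: "norm_positive (x * st x + st x * x)"
proof -
  define s :: real where "s = sqrt (1/2)"
  have s: "s * s = 1/2" by (simp add: s_def flip: power2_eq_square)
  define a where "a = s *\<^sub>R (x + st x)"
  define b where "b = s *\<^sub>R sc \<i> (x - st x)"
  have "st a = a" "st b = b"
    by (simp_all add: a_def b_def st_simps sc_i_simps add.commute)
  then have "norm_positive (a * a + b * b)"
    by (intro norm_positive_add norm_positive_square)
  moreover have "a * a = (1/2) *\<^sub>R ((x + st x) * (x + st x))"
    by (simp add: a_def s)
  moreover have "b * b = - ((1/2) *\<^sub>R ((x - st x) * (x - st x)))"
    by (simp add: b_def s sc.scaleR sc_i_sc_i flip: sc_mult_left sc_mult_right)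
  moreover have "(1/2) *\<^sub>R ((x + st x) * (x + st x)) + - ((1/2) *\<^sub>R ((x - st x) * (x - st x)))
      = (1/2) *\<^sub>R (2 *\<^sub>R (x * st x + st x * x))"
    unfolding scaleR_minus_right[symmetric] scaleR_right_distrib[symmetric]
    by (simp add: algebra_simps scaleR_2)
  ultimately show ?thesis by simp
qed

lemma cproj_eq_0_if_norm_positive_minus:
  assumes "cproj st p" "norm_positive (- p)"
  shows "p = 0"
proof -
  obtain M where M: "norm (M *\<^sub>R p - (- p) * p) \<le> M * norm p" "M \<ge> 0"
    using assms(2) by (auto simp: norm_positive_def)
  have "M *\<^sub>R p - (- p) * p = (M + 1) *\<^sub>R p"
    using assms(1) by (simp add: cproj_def scaleR_left_distrib)
  then show ?thesis using M by (simp add: distrib_right)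
qed

text \<open>The special case of the Kelley-Vaught theorem that is needed: (x* x)^2 = - x* x, so that
- p is the sum (x x* + x* x) + (x* x)^2 of positive elements.\<close>
lemma cproj_eq_0_if_mult_st_eq_minus:
  assumes p: "cproj st p" and x: "x * st x = - p"
  shows "p = 0"
proof (rule cproj_eq_0_if_norm_positive_minus[OF p])
  have pp: "st p = p" "p * p = p" using p by (auto simp: cproj_def)
  have "(x - p * x) * st (x - p * x) =
      x * st x - x * st x * p - p * (x * st x) + p * (x * st x) * p"
    by (simp add: st_simps pp algebra_simps)
  also have "\<dots> = 0" by (simp add: x pp)
  finally have px: "p * x = x" using mult_st_eq_0[of "x - p * x"] by simp
  have "(st x * x) * (st x * x) = st x * (x * st x) * x" by (simp only: mult.assoc)
  also have "\<dots> = - (st x * x)" by (simp add: x px mult.assoc)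
  finally have "(x * st x + st x * x) + (st x * x) * (st x * x) = - p" by (simp add: x)
  moreover have "norm_positive ((x * st x + st x * x) + (st x * x) * (st x * x))"
    by (intro norm_positive_add norm_positive_mult_st_add_st_mult norm_positive_square)
      (simp add: st_simps)
  ultimately show "norm_positive (- p)" by simp
qed

lemma mult_st_eq_if_square_eq_cproj:
  assumes f: "cproj st f" and v: "f * v = v" "(v * st v) * (v * st v) = f"
  shows "v * st v = f"
proof -
  define s where "s = v * st v"
  have ff: "st f = f" "f * f = f" using f by (auto simp: cproj_def)
  have s: "st s = s" "s * s = f" "f * s = s"
    using v by (simp_all add: s_def st_simps flip: mult.assoc)
  have sf: "s * f = s" using st_mult_cproj[OF f s(3)] by (simp add: s)
  define p where "p = (1/2) *\<^sub>R (f - s)"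
  have p: "st p = p" "p * p = p"
    by (simp_all add: p_def st_simps ff s sf algebra_simps flip: scaleR_left_distrib)
  have "(p * v) * st (p * v) = p * s * p" by (simp add: s_def st_simps p mult.assoc)
  also have "\<dots> = - p"
    by (simp add: p_def ff s sf algebra_simps flip: scaleR_left_distrib)
  finally have "p = 0"
    using p by (intro cproj_eq_0_if_mult_st_eq_minus[of _ "p * v"]) (simp_all add: cproj_def)
  then show ?thesis by (simp add: p_def s_def)
qed

section \<open>Polar decomposition\<close>

lemma norm_cproj_minus_square_le_1:
  assumes f: "cproj st f" and k: "st k = k" "f * k = k" "norm k \<le> 1"
  shows "norm (f - k * k) \<le> 1"
  using norm_minus_square_mult_le[OF k(1,3), of f] norm_cproj_le_1[OF f] st_mult_cproj[OF f k(2)]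
  by (simp add: k(1) mult.assoc)

lemma selfadj_corner_right_inverse:
  assumes f: "cproj st f" and "st h = h" and z: "f * z = z" "h * z = f"
  shows "st z = z"
proof -
  have "st z * f = st z" by (rule st_mult_cproj[OF f z(1)])
  moreover have "st z * h = f" using assms by (metis cproj_def st_mult)
  ultimately show ?thesis by (metis z mult.assoc)
qed

lemma selfadj_corner_inverse:
  assumes f: "cproj st f" and h: "st h = h" "f * h = h"
    and "\<delta> > 0" and below: "\<And>b. f * b = b \<Longrightarrow> \<delta> * norm b \<le> norm (h * b)"
  obtains z where "st z = z" "f * z = z" "h * z = f"
proof -
  have ff: "st f = f" "f * f = f" using f by (auto simp: cproj_def)
  obtain N k where N: "N > 0" "h = N *\<^sub>R k" and k: "st k = k" "norm k \<le> 1"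
    using selfadj_scaled_contraction[OF h(1)] .
  have fk: "f * k = k" using h(2) N by simp
  have k_below: "(\<delta> / N) * norm b \<le> norm (k * b)" if "f * b = b" for b
    using below[OF that] N by (simp add: field_simps)
  have "norm (f - k * k) \<le> 1" by (rule norm_cproj_minus_square_le_1[OF f k(1) fk k(2)])
  moreover have "f * (f - k * k) = f - k * k"
    by (simp add: right_diff_distrib ff fk flip: mult.assoc)
  moreover have "(\<delta> / N)\<^sup>2 * norm b \<le> norm (b - (f - k * k) * b)" if b: "f * b = b" for b
  proof -
    have "(\<delta> / N)\<^sup>2 * norm b \<le> (\<delta> / N) * norm (k * b)"
      using mult_left_mono[OF k_below[OF b], of "\<delta> / N"] \<open>\<delta> > 0\<close> N(1)
      by (simp add: power2_eq_square)
    also have "\<dots> \<le> norm (k * (k * b))" by (rule k_below) (simp add: fk flip: mult.assoc)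
    finally show ?thesis using b by (simp add: algebra_simps)
  qed
  ultimately obtain y where y: "f * y = y" "(f - (f - k * k)) * y = f"
    using corner_right_inverse_if_bounded_below[OF ff(2) norm_cproj_le_1[OF f], of "f - k * k"
        "(\<delta> / N)\<^sup>2"] \<open>\<delta> > 0\<close> N(1) by auto
  define z where "z = (1 / N) *\<^sub>R (k * y)"
  have hz: "h * z = f" using y(2) N by (simp add: z_def mult.assoc)
  have fz: "f * z = z" by (simp add: z_def fk flip: mult.assoc)
  have "st z = z" by (rule selfadj_corner_right_inverse[OF f h(1) fz hz])
  with fz hz show thesis by (intro that)
qed

lemma fourth_root_of_square:
  assumes f: "cproj st f" and z: "st z = z" "f * z = z" "h * z = z * h" "f * h = h * f"
  obtains c where "st c = c" "f * c = c" "h * c = c * h" "(c * c) * (c * c) = z * z"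
proof -
  have ff: "st f = f" "f * f = f" using f by (auto simp: cproj_def)
  obtain N k where N: "N > 0" "z = N *\<^sub>R k" and "st k = k" "norm k \<le> 1"
    using selfadj_scaled_contraction[OF z(1)] .
  with z have k: "st k = k" "norm k \<le> 1" "f * k = k" "h * k = k * h" by simp_all
  have kf: "k * f = k" using st_mult_cproj[OF f k(3)] by (simp add: k(1))
  have kk: "f * (k * k) = k * k" "k * k * f = k * k" "norm (f - k * k) \<le> 1"
    using norm_cproj_minus_square_le_1[OF f k(1,3,2)] by (simp_all add: kf mult.assoc)
      (simp add: k flip: mult.assoc)
  define r where "r = corner_sqrt f (k * k)"
  have r: "st r = r" "f * r = r" "r * f = r" "r * r = k * k" "norm (f - r) \<le> 1" "h * r = r * h"
    unfolding r_def using kk k(1,4) z(4) ff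
    by (simp_all add: st_corner_sqrt st_simps mult_corner_sqrt corner_sqrt_mult corner_sqrt_square
        norm_minus_corner_sqrt_le_1) (metis corner_sqrt_commute mult.assoc)
  define d where "d = corner_sqrt f r"
  have d: "st d = d" "f * d = d" "d * d = r" "h * d = d * h"
    unfolding d_def using r ff z(4)
    by (simp_all add: st_corner_sqrt mult_corner_sqrt corner_sqrt_square corner_sqrt_commute)
  show thesis
  proof
    show "st (sqrt N *\<^sub>R d) = sqrt N *\<^sub>R d" "f * sqrt N *\<^sub>R d = sqrt N *\<^sub>R d"
      "h * sqrt N *\<^sub>R d = sqrt N *\<^sub>R d * h"
      by (simp_all add: st_simps d)
    show "(sqrt N *\<^sub>R d * sqrt N *\<^sub>R d) * (sqrt N *\<^sub>R d * sqrt N *\<^sub>R d) = z * z"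
      using N by (simp add: d r)
  qed
qed

text \<open>Since f = y* w*, the element w w* is bounded below.\<close>
lemma mult_st_corner_inverse:
  assumes f: "cproj st f" and w: "f * w = w" "w * y = f"
  obtains z where "st z = z" "f * z = z" "w * st w * z = f"
proof -
  have ff: "st f = f" "f * f = f" using f by (auto simp: cproj_def)
  define h where "h = w * st w"
  have h: "st h = h" "f * h = h" by (simp_all add: h_def st_simps w flip: mult.assoc)
  define \<delta> where "\<delta> = 1 / ((norm y)\<^sup>2 + 1)"
  have "\<delta> > 0" by (simp add: \<delta>_def add_nonneg_pos)
  moreover have "\<delta> * norm b \<le> norm (h * b)" if b: "f * b = b" for b
  proof (cases "b = 0")
    case False
    have "(norm (st w * b))\<^sup>2 = norm (st b * (h * b))"
      by (simp add: h_def st_simps mult.assoc flip: cstar_id)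
    also have "\<dots> \<le> norm b * norm (h * b)"
      using norm_mult_ineq[of "st b" "h * b"] by (simp add: norm_st)
    finally have st_w_b: "(norm (st w * b))\<^sup>2 \<le> norm b * norm (h * b)" .
    have "norm b \<le> norm y * norm (st w * b)"
      using norm_mult_ineq[of "st y" "st w * b"] arg_cong[OF w(2), of st] b
      by (simp add: st_simps ff norm_st flip: mult.assoc)
    then have "(norm b)\<^sup>2 \<le> (norm y)\<^sup>2 * (norm (st w * b))\<^sup>2"
      by (metis norm_ge_zero power_mono power_mult_distrib)
    also have "\<dots> \<le> (norm y)\<^sup>2 * (norm b * norm (h * b))"
      by (intro mult_left_mono st_w_b) simp
    finally have "norm b * norm b \<le> norm b * ((norm y)\<^sup>2 * norm (h * b))"
      by (simp add: power2_eq_square mult_ac)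
    then have "norm b \<le> (norm y)\<^sup>2 * norm (h * b)" using False by simp
    also have "\<dots> \<le> ((norm y)\<^sup>2 + 1) * norm (h * b)" by (simp add: mult_right_mono)
    finally show ?thesis by (simp add: \<delta>_def field_simps add_pos_nonneg)
  qed simp
  ultimately obtain z where "st z = z" "f * z = z" "h * z = f"
    by (rule selfadj_corner_inverse[OF f h])
  then show thesis unfolding h_def by (rule that)
qed

text \<open>The coisometry is |h|^(-1/2) w for h = w w*.\<close>
lemma right_invertible_polar:
  assumes f: "cproj st f" and w: "f * w = w" "w * y = f"
  obtains v where "v * st v = f" "f * v = v" "w * (st v * v) = w"
proof -
  have ff: "st f = f" "f * f = f" using f by (auto simp: cproj_def)
  define h where "h = w * st w"
  have h: "st h = h" "f * h = h" by (simp_all add: h_def st_simps w flip: mult.assoc)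
  have hf: "h * f = h" using st_mult_cproj[OF f h(2)] by (simp add: h(1))
  obtain z where z: "st z = z" "f * z = z" "h * z = f"
    unfolding h_def using mult_st_corner_inverse[OF f w] .
  have zh: "z * h = f" by (metis st_mult ff(1) h(1) z(1,3))
  obtain c where c: "st c = c" "f * c = c" "h * c = c * h" "(c * c) * (c * c) = z * z"
    by (rule fourth_root_of_square[OF f z(1,2), of h]) (simp_all add: z zh h hf)
  define v where "v = c * w"
  have fv: "f * v = v" by (simp add: v_def c flip: mult.assoc)
  have "v * st v = c * h * c" by (simp add: v_def h_def st_simps c mult.assoc)
  then have vv: "v * st v = h * (c * c)" by (simp add: mult.assoc flip: c(3))
  have "c * c * h = h * (c * c)" by (metis c(3) mult.assoc)
  then have "h * (c * c) * (h * (c * c)) = h * (h * ((c * c) * (c * c)))" by (metis mult.assoc)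
  also have "\<dots> = h * (h * z * z)" unfolding c(4) by (simp only: mult.assoc)
  finally have "h * (c * c) * (h * (c * c)) = f" by (simp add: z)
  then have vf: "v * st v = f"
    by (intro mult_st_eq_if_square_eq_cproj[OF f fv]) (simp add: vv)
  have "w * (st v * v) = h * (c * c) * w" by (simp add: v_def h_def st_simps c(1) mult.assoc)
  then have "w * (st v * v) = w" using vf by (simp add: vv w)
  with vf fv show thesis by (rule that)
qed

section \<open>Multipliers\<close>

lemma double_centralizer_linear:
  fixes L R :: "'a \<Rightarrow> 'a"
  assumes "double_centralizer L R"
  shows "linear L"
proof -
  have RL: "a * L b = R a * b" for a b using assms by (auto simp: double_centralizer_def)
  show ?thesis
  proof (rule linearI; rule eq_if_left_mult_eq)
    show "a * L (x + y) = a * (L x + L y)" for a x y by (simp add: RL distrib_left)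
    show "a * L (c *\<^sub>R x) = a * c *\<^sub>R L x" for a c x by (simp add: RL)
  qed
qed

text \<open>Without boundedness the operator norm in the closure hypothesis would be a junk value.
By the C*-identity, the norm of L b is the supremum of the norms of R a * b with a in the unit
ball.\<close>
lemma double_centralizer_bounded_linear:
  fixes L R :: "'a \<Rightarrow> 'a"
  assumes dc: "double_centralizer L R"
  shows "bounded_linear L"
proof -
  have RL: "R a * b = a * L b" for a b using dc by (auto simp: double_centralizer_def)
  have "\<exists>K. \<forall>a\<in>{a. norm a \<le> 1}. norm (R a * b) \<le> K" for b
  proof (intro exI ballI)
    fix a :: 'a assume "a \<in> {a. norm a \<le> 1}"
    then show "norm (R a * b) \<le> norm (L b)"
      using norm_mult_ineq[of a "L b"] mult_right_mono[of "norm a" 1 "norm (L b)"] by (simp add: RL)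
  qed
  then obtain K where K: "\<And>a b. a \<in> {a. norm a \<le> 1} \<Longrightarrow> norm (R a * b) \<le> K * norm b"
    using uniform_boundedness[of "{a. norm a \<le> 1}" "\<lambda>a b. R a * b"]
    by (metis bounded_linear_mult_right)
  have "norm (L b) \<le> K * norm b" for b
  proof -
    have "norm (st (L b) * a) \<le> K * norm b" if "norm a \<le> 1" for a
      using K[of "st a" b] that norm_st[of "st a * L b"] by (simp add: RL st_simps norm_st)
    then have "norm (st (L b)) \<le> K * norm b" by (rule norm_le_if_mult_unit_ball_le)
    then show ?thesis by (simp add: norm_st)
  qed
  then show ?thesis
    using double_centralizer_linear[OF dc]
    by (intro bounded_linear_intro[where K = K])
      (simp_all add: linear_add linear_scale mult.commute)
qed

lemma norm_mult_minus_centralizer_le: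
  fixes f t :: 'a
  assumes dc: "double_centralizer L R" and f: "cproj st f"
  shows "norm (f * t - R f) \<le> onorm (\<lambda>b. t * b - L b)"
proof (rule norm_le_if_mult_unit_ball_le)
  fix b :: 'a assume b: "norm b \<le> 1"
  have bl: "bounded_linear (\<lambda>b. t * b - L b)"
    by (intro bounded_linear_sub bounded_linear_mult_right double_centralizer_bounded_linear[OF dc])
  have "R f * b = f * L b" using dc by (auto simp: double_centralizer_def)
  then have "(f * t - R f) * b = f * (t * b - L b)" by (simp add: algebra_simps)
  then have "norm ((f * t - R f) * b) \<le> 1 * norm (t * b - L b)"
    using norm_mult_ineq[of f "t * b - L b"]
      mult_right_mono[OF norm_cproj_le_1[OF f], of "norm (t * b - L b)"] by simp
  also have "\<dots> \<le> onorm (\<lambda>b. t * b - L b) * norm b"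
    using onorm[OF bl, of b] by simp
  also have "\<dots> \<le> onorm (\<lambda>b. t * b - L b)"
    using b onorm_pos_le[OF bl] by (simp add: mult_left_le)
  finally show "norm ((f * t - R f) * b) \<le> onorm (\<lambda>b. t * b - L b)" .
qed

lemma corner_approx_right_invertible:
  fixes f t :: 'a
  assumes clo: "in_closure_invertible_multipliers TYPE('a)" and f: "cproj st f" and "\<epsilon> > 0"
  obtains w y where "f * w = w" "w * y = f" "norm (f * t - w) < \<epsilon>"
proof -
  have ff: "f * f = f" using f by (simp add: cproj_def)
  obtain L R where LR: "mult_invertible L R" "onorm (\<lambda>b. t * b - L b) < \<epsilon>"
    using clo \<open>\<epsilon> > 0\<close> unfolding in_closure_invertible_multipliers_def by blast
  obtain L' where dc: "double_centralizer L R" and L': "L \<circ> L' = id"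
    using LR(1) by (auto simp: mult_invertible_def)
  have R: "R (a * b) = a * R b" and RL: "R a * b = a * L b" for a b
    using dc by (auto simp: double_centralizer_def)
  have "norm (f * t - R f) < \<epsilon>"
    using norm_mult_minus_centralizer_le[OF dc f, of t] LR(2) by simp
  moreover have "f * R f = R f" using R[of f f] by (simp add: ff)
  moreover have "R f * L' f = f" using fun_cong[OF L', of f] by (simp add: RL ff)
  ultimately show thesis using that by blast
qed

lemma right_support_approx:
  fixes f t :: 'a
  assumes clo: "in_closure_invertible_multipliers TYPE('a)" and f: "cproj st f" and "\<epsilon> > 0"
  obtains v w where "cproj st (st v * v)" "v * st v = f" "w * (st v * v) = w"
    "norm (f * t - w) < \<epsilon>"
proof -
  obtain w y where w: "f * w = w" "w * y = f" "norm (f * t - w) < \<epsilon>"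
    using corner_approx_right_invertible[OF clo f \<open>\<epsilon> > 0\<close>] .
  obtain v where v: "v * st v = f" "f * v = v" "w * (st v * v) = w"
    using right_invertible_polar[OF f w(1,2)] .
  have "(st v * v) * (st v * v) = st v * ((v * st v) * v)" by (simp only: mult.assoc)
  then have "cproj st (st v * v)" by (simp add: cproj_def st_simps v)
  then show thesis using v w by (intro that)
qed

end

section \<open>Matrices\<close>

type_synonym 'a mat = "nat \<Rightarrow> nat \<Rightarrow> 'a"

definition mat_mult :: "nat \<Rightarrow> 'a::semiring_0 mat \<Rightarrow> 'a mat \<Rightarrow> 'a mat" where
  "mat_mult N X Y = (\<lambda>i j. \<Sum>k<N. X i k * Y k j)"

definition mat_size :: "nat \<Rightarrow> nat \<Rightarrow> 'a::zero mat \<Rightarrow> bool" where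
  "mat_size m n X \<longleftrightarrow> (\<forall>i j. m \<le> i \<or> n \<le> j \<longrightarrow> X i j = 0)"

definition block_diag :: "nat \<Rightarrow> nat \<Rightarrow> 'a::zero mat \<Rightarrow> 'a mat \<Rightarrow> 'a mat" where
  "block_diag m n X Y = (\<lambda>i j. if i < m \<and> j < n then X i j
                               else if m \<le> i \<and> n \<le> j then Y (i - m) (j - n) else 0)"

definition mat_single :: "'a::zero \<Rightarrow> 'a mat" where
  "mat_single a = (\<lambda>i j. if i = 0 \<and> j = 0 then a else 0)"

lemma mat_mult_assoc: "mat_mult N (mat_mult M X Y) Z = mat_mult M X (mat_mult N Y Z)"
proof (intro ext)
  fix i j
  have "mat_mult N (mat_mult M X Y) Z i j = (\<Sum>k<N. \<Sum>l<M. X i l * Y l k * Z k j)"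
    by (simp add: mat_mult_def sum_distrib_right)
  also have "\<dots> = (\<Sum>l<M. \<Sum>k<N. X i l * Y l k * Z k j)" by (rule sum.swap)
  also have "\<dots> = mat_mult M X (mat_mult N Y Z) i j"
    by (simp add: mat_mult_def sum_distrib_left mult.assoc)
  finally show "mat_mult N (mat_mult M X Y) Z i j = mat_mult M X (mat_mult N Y Z) i j" .
qed

lemma mat_size_mono: "mat_size m n X \<Longrightarrow> m \<le> m' \<Longrightarrow> n \<le> n' \<Longrightarrow> mat_size m' n' X"
  by (auto simp: mat_size_def)

lemma mat_size_mult: "mat_size m l X \<Longrightarrow> mat_size l' n Y \<Longrightarrow> mat_size m n (mat_mult N X Y)"
  by (auto simp: mat_size_def mat_mult_def)

lemma mat_mult_size_cong:
  assumes "mat_size a c Y" "mat_size b d Y"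
  shows "mat_mult a X Y = mat_mult b X Y"
proof (intro ext)
  fix i j
  have "mat_mult a X Y i j = (\<Sum>k<min a b. X i k * Y k j)"
    unfolding mat_mult_def by (rule sum.mono_neutral_right) (use assms in \<open>auto simp: mat_size_def\<close>)
  also have "\<dots> = mat_mult b X Y i j"
    unfolding mat_mult_def by (rule sum.mono_neutral_left) (use assms in \<open>auto simp: mat_size_def\<close>)
  finally show "mat_mult a X Y i j = mat_mult b X Y i j" .
qed

lemma sum_lessThan_add:
  fixes F :: "nat \<Rightarrow> 'a::comm_monoid_add"
  shows "sum F {..<m + n} = sum F {..<m} + (\<Sum>k<n. F (m + k))"
  by (induction n) (simp_all add: add.assoc)

lemma mat_mult_block_diag:
  "mat_mult (b + b') (block_diag a b X Y) (block_diag b c X' Y') =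
    block_diag a c (mat_mult b X X') (mat_mult b' Y Y')"
  by (intro ext) (auto simp: mat_mult_def sum_lessThan_add block_diag_def)

lemma mat_size_block_diag: "mat_size m n Y \<Longrightarrow> mat_size (a + m) (b + n) (block_diag a b X Y)"
  by (auto simp: mat_size_def block_diag_def)

lemma block_diag_assoc:
  "block_diag (a + b) (a + b) (block_diag a a X Y) Z = block_diag a a X (block_diag b b Y Z)"
  by (intro ext) (auto simp: block_diag_def)

section \<open>Murray--von Neumann equivalence of matrices over A\<close>

context cstar_algebra
begin

definition mat_star :: "'a mat \<Rightarrow> 'a mat" where
  "mat_star X = (\<lambda>i j. st (X j i))"

definition mat_proj :: "nat \<Rightarrow> 'a mat \<Rightarrow> bool" where
  "mat_proj n P \<longleftrightarrow> mat_size n n P \<and> mat_star P = P \<and> mat_mult n P P = P"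

text \<open>Unlike in mvn_A, the partial isometry is rectangular of the sizes of the two projections.\<close>
definition mat_equiv :: "nat \<Rightarrow> 'a mat \<Rightarrow> nat \<Rightarrow> 'a mat \<Rightarrow> bool" where
  "mat_equiv n P m Q \<longleftrightarrow>
    (\<exists>v. mat_size m n v \<and> mat_mult m (mat_star v) v = P \<and> mat_mult n v (mat_star v) = Q)"

definition mat_subequiv :: "nat \<Rightarrow> 'a mat \<Rightarrow> nat \<Rightarrow> 'a mat \<Rightarrow> bool" where
  "mat_subequiv n P m Q \<longleftrightarrow> (\<exists>k E. mat_proj k E \<and> mat_equiv m Q (n + k) (block_diag n n P E))"

lemma mat_star_mult: "mat_star (mat_mult N X Y) = mat_mult N (mat_star Y) (mat_star X)"
  by (simp add: mat_star_def mat_mult_def st.sum st_mult)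

lemma mat_star_star: "mat_star (mat_star X) = X"
  by (simp add: mat_star_def st_st)

lemma mat_size_star: "mat_size m n (mat_star X) \<longleftrightarrow> mat_size n m X"
  by (auto simp: mat_size_def mat_star_def st.zero) (metis st_st st.zero)+

lemma mat_star_block_diag:
  "mat_star (block_diag a b X Y) = block_diag b a (mat_star X) (mat_star Y)"
  by (intro ext) (auto simp: mat_star_def block_diag_def st.zero)

lemma mat_proj_block_diag:
  "mat_proj n P \<Longrightarrow> mat_proj m Q \<Longrightarrow> mat_proj (n + m) (block_diag n n P Q)"
  by (simp add: mat_proj_def mat_size_block_diag mat_star_block_diag mat_mult_block_diag)

lemma mat_proj_single: "cproj st p \<Longrightarrow> mat_proj 1 (mat_single p)"
  by (auto simp: mat_proj_def mat_size_def mat_single_def mat_star_def mat_mult_def cproj_def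
      st.zero fun_eq_iff)

lemma mat_equiv_refl: "mat_proj n P \<Longrightarrow> mat_equiv n P n P"
  unfolding mat_proj_def mat_equiv_def by (intro exI[of _ P]) auto

lemma mat_equiv_sym: "mat_equiv n P m Q \<Longrightarrow> mat_equiv m Q n P"
  unfolding mat_equiv_def by (metis mat_star_star mat_size_star)

lemma mat_star_mult_composite:
  assumes "mat_mult n v (mat_star v) = mat_mult l (mat_star w) w"
  shows "mat_mult l (mat_star (mat_mult m w v)) (mat_mult m w v) =
    mat_mult n (mat_mult m (mat_star v) v) (mat_mult m (mat_star v) v)"
proof -
  have "mat_mult l (mat_star (mat_mult m w v)) (mat_mult m w v) =
      mat_mult m (mat_star v) (mat_mult m (mat_mult l (mat_star w) w) v)"
    by (simp add: mat_star_mult mat_mult_assoc)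
  also have "\<dots> = mat_mult n (mat_mult m (mat_star v) v) (mat_mult m (mat_star v) v)"
    by (simp add: mat_mult_assoc flip: assms)
  finally show ?thesis .
qed

lemma mat_equiv_trans:
  assumes P: "mat_proj n P" and R: "mat_proj l R"
    and PQ: "mat_equiv n P m Q" and QR: "mat_equiv m Q l R"
  shows "mat_equiv n P l R"
proof -
  obtain v where v: "mat_size m n v" "mat_mult m (mat_star v) v = P" "mat_mult n v (mat_star v) = Q"
    using PQ by (auto simp: mat_equiv_def)
  obtain w where w: "mat_size l m w" "mat_mult l (mat_star w) w = Q" "mat_mult m w (mat_star w) = R"
    using QR by (auto simp: mat_equiv_def)
  have "mat_mult l (mat_star (mat_mult m w v)) (mat_mult m w v) = P"
    using mat_star_mult_composite[of n v l w m] P by (simp add: v w mat_proj_def)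
  moreover have "mat_mult n (mat_mult m w v) (mat_star (mat_mult m w v)) = R"
    using mat_star_mult_composite[of l "mat_star w" n "mat_star v" m] R
    by (simp add: v w mat_star_star mat_star_mult mat_proj_def)
  ultimately show ?thesis
    unfolding mat_equiv_def using mat_size_mult[OF w(1) v(1)] by blast
qed

lemma mat_equiv_block_diag:
  assumes "mat_equiv n P n' P'" "mat_equiv m Q m' Q'"
  shows "mat_equiv (n + m) (block_diag n n P Q) (n' + m') (block_diag n' n' P' Q')"
proof -
  obtain v where v: "mat_size n' n v" "mat_mult n' (mat_star v) v = P"
    "mat_mult n v (mat_star v) = P'"
    using assms(1) by (auto simp: mat_equiv_def)
  obtain w where w: "mat_size m' m w" "mat_mult m' (mat_star w) w = Q"
    "mat_mult m w (mat_star w) = Q'"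
    using assms(2) by (auto simp: mat_equiv_def)
  show ?thesis unfolding mat_equiv_def
    using v w by (intro exI[of _ "block_diag n' n v w"])
      (simp add: mat_star_block_diag mat_mult_block_diag mat_size_block_diag)
qed

lemma mat_equiv_block_diag_commute:
  assumes P: "mat_proj n P" and Q: "mat_proj m Q"
  shows "mat_equiv (n + m) (block_diag n n P Q) (m + n) (block_diag m m Q P)"
proof -
  define v where "v = (\<lambda>i j. if i < m \<and> n \<le> j then Q i (j - n)
     else if m \<le> i \<and> j < n then P (i - m) j else 0)"
  have adjoint: "st (P i j) = P j i" "st (Q i j) = Q j i" for i j
    using P Q by (auto simp: mat_proj_def mat_star_def dest: fun_cong)
  have idem: "(\<Sum>k<n. P i k * P k j) = P i j" "(\<Sum>k<m. Q i k * Q k j) = Q i j" for i j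
    using P Q by (auto simp: mat_proj_def mat_mult_def dest: fun_cong)
  have "mat_size (m + n) (n + m) v"
    using P Q by (auto simp: mat_proj_def mat_size_def v_def)
  moreover have "mat_mult (m + n) (mat_star v) v = block_diag n n P Q"
    by (intro ext) (auto simp: mat_mult_def mat_star_def sum_lessThan_add v_def block_diag_def
        adjoint idem st.zero)
  moreover have "mat_mult (n + m) v (mat_star v) = block_diag m m Q P"
    by (intro ext) (auto simp: mat_mult_def mat_star_def sum_lessThan_add v_def block_diag_def
        adjoint idem st.zero)
  ultimately show ?thesis unfolding mat_equiv_def by blast
qed

lemma mat_equiv_block_diag_interchange:
  assumes "mat_proj a P" "mat_proj b E" "mat_proj c Q" "mat_proj d F"
  shows "mat_equiv
    ((a + b) + (c + d)) (block_diag (a + b) (a + b) (block_diag a a P E) (block_diag c c Q F))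
    ((a + c) + (b + d)) (block_diag (a + c) (a + c) (block_diag a a P Q) (block_diag b b E F))"
proof -
  have "mat_equiv
      (a + ((b + c) + d)) (block_diag a a P (block_diag (b + c) (b + c) (block_diag b b E Q) F))
      (a + ((c + b) + d)) (block_diag a a P (block_diag (c + b) (c + b) (block_diag c c Q E) F))"
    using assms by (intro mat_equiv_block_diag mat_equiv_refl mat_equiv_block_diag_commute)
  then show ?thesis by (simp only: block_diag_assoc add.assoc)
qed

lemma mat_equiv_single: "mat_equiv 1 (mat_single (st v * v)) 1 (mat_single (v * st v))"
  unfolding mat_equiv_def
  by (intro exI[of _ "mat_single v"])
    (auto simp: mat_size_def mat_single_def mat_star_def mat_mult_def st.zero fun_eq_iff)

lemma mat_subequiv_0:
  assumes "mat_proj n P"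
  shows "mat_subequiv 1 (mat_single 0) n P"
proof -
  have "mat_equiv 0 (\<lambda>_ _. 0) 1 (mat_single 0)"
    unfolding mat_equiv_def
    by (intro exI[of _ "\<lambda>_ _. 0"])
      (auto simp: mat_size_def mat_mult_def mat_single_def mat_star_def)
  from mat_equiv_block_diag[OF this mat_equiv_refl[OF assms]] assms show ?thesis
    by (auto simp: mat_subequiv_def block_diag_def)
qed

lemma mat_subequiv_cong:
  assumes proj: "mat_proj n P" "mat_proj n' P'" "mat_proj m Q"
    and "mat_equiv n P n' P'" "mat_subequiv n P m Q"
  shows "mat_subequiv n' P' m Q"
proof -
  obtain k E where E: "mat_proj k E" "mat_equiv m Q (n + k) (block_diag n n P E)"
    using assms by (auto simp: mat_subequiv_def)
  have "mat_equiv (n + k) (block_diag n n P E) (n' + k) (block_diag n' n' P' E)"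
    using assms E by (intro mat_equiv_block_diag mat_equiv_refl)
  with E have "mat_equiv m Q (n' + k) (block_diag n' n' P' E)"
    using proj by (blast intro: mat_equiv_trans mat_proj_block_diag)
  with E show ?thesis by (auto simp: mat_subequiv_def)
qed

lemma mat_subequiv_block_diag:
  assumes proj: "mat_proj n P" "mat_proj n' P'" "mat_proj m Q" "mat_proj m' Q'"
    and "mat_subequiv n P n' P'" "mat_subequiv m Q m' Q'"
  shows "mat_subequiv (n + m) (block_diag n n P Q) (n' + m') (block_diag n' n' P' Q')"
proof -
  obtain k E l F where E: "mat_proj k E" "mat_equiv n' P' (n + k) (block_diag n n P E)"
    and F: "mat_proj l F" "mat_equiv m' Q' (m + l) (block_diag m m Q F)"
    using assms by (auto simp: mat_subequiv_def)
  have "mat_equiv (n' + m') (block_diag n' n' P' Q')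
      ((n + m) + (k + l)) (block_diag (n + m) (n + m) (block_diag n n P Q) (block_diag k k E F))"
    by (rule mat_equiv_trans[OF _ _ mat_equiv_block_diag[OF E(2) F(2)]
          mat_equiv_block_diag_interchange]) (intro mat_proj_block_diag proj E F)+
  then show ?thesis
    unfolding mat_subequiv_def using mat_proj_block_diag[OF E(1) F(1)] by blast
qed

section \<open>The ordered group K_0\<close>

definition mat_lift :: "'a mat \<Rightarrow> 'a umat" where
  "mat_lift X = (\<lambda>i j. (X i j, 0))"

lemma in_A_iff_lift: "in_A M \<longleftrightarrow> (\<exists>X. M = mat_lift X)"
proof
  assume "in_A M"
  then have "M = mat_lift (\<lambda>i j. fst (M i j))"
    by (intro ext prod_eqI) (auto simp: in_A_def mat_lift_def)
  then show "\<exists>X. M = mat_lift X" by blast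
qed (auto simp: in_A_def mat_lift_def)

lemma mat_lift_inject: "mat_lift X = mat_lift Y \<longleftrightarrow> X = Y"
  by (auto simp: mat_lift_def fun_eq_iff)

lemma umm_lift: "umm sc N (mat_lift X) (mat_lift Y) = mat_lift (mat_mult N X Y)"
proof -
  have "sc 0 x = 0" for x using sc_of_real[of 0 x] by simp
  moreover have "(\<Sum>k\<in>S. (F k, 0)) = (sum F S, 0 :: complex)" for F :: "nat \<Rightarrow> 'a" and S
    by (induction S rule: infinite_finite_induct) (auto simp: zero_prod_def)
  ultimately show ?thesis by (simp add: umm_def mat_lift_def mat_mult_def umult_def)
qed

lemma ustar_m_lift: "ustar_m st (mat_lift X) = mat_lift (mat_star X)"
  by (simp add: ustar_m_def ustar_def mat_lift_def mat_star_def)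

lemma supp_in_lift: "supp_in n (mat_lift X) \<longleftrightarrow> mat_size n n X"
  by (simp add: supp_in_def mat_lift_def mat_size_def zero_prod_def)

lemmas lift_simps = supp_in_lift ustar_m_lift umm_lift mat_lift_inject

lemma single_lift: "single a = mat_lift (mat_single a)"
  by (intro ext) (simp add: single_def mat_lift_def mat_single_def zero_prod_def)

lemma k0_add_lift: "k0_add (n, mat_lift X) (m, mat_lift Y) = (n + m, mat_lift (block_diag n n X Y))"
  by (auto simp: k0_add_def dsum_def mat_lift_def block_diag_def zero_prod_def fun_eq_iff)

lemma proj_A_lift: "proj_A sc st n (mat_lift P) \<longleftrightarrow> mat_proj n P"
  using in_A_iff_lift by (auto simp: proj_A_def uproj_def mat_proj_def lift_simps)

lemma proj_A_iff: "proj_A sc st n p \<longleftrightarrow> (\<exists>P. p = mat_lift P \<and> mat_proj n P)"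
  using proj_A_lift in_A_iff_lift by (metis proj_A_def)

definition k0_cone :: "(nat \<times> 'a umat) set" where
  "k0_cone = {(n, p). proj_A sc st n p}"

lemma k0_cone_iff: "x \<in> k0_cone \<longleftrightarrow> (\<exists>n P. x = (n, mat_lift P) \<and> mat_proj n P)"
  by (auto simp: k0_cone_def proj_A_iff)

lemma k0_cone_add: "x \<in> k0_cone \<Longrightarrow> y \<in> k0_cone \<Longrightarrow> k0_add x y \<in> k0_cone"
  by (auto simp: k0_cone_iff k0_add_lift mat_lift_inject mat_proj_block_diag)

lemma k0_cone_single: "cproj st p \<Longrightarrow> (1, single p) \<in> k0_cone"
  using mat_proj_single by (simp add: k0_cone_def single_lift proj_A_lift)

lemma mat_equiv_if_square:
  assumes P: "mat_proj n P" and Q: "mat_proj m Q"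
    and u: "mat_size N N u" "mat_size N N P" "mat_size N N Q"
      "mat_mult N (mat_star u) u = P" "mat_mult N u (mat_star u) = Q"
  shows "mat_equiv n P m Q"
proof -
  have nP: "mat_size n n P" "mat_star P = P" "mat_mult N P P = P"
    using P mat_mult_size_cong[of N N P n n P] u(2) by (auto simp: mat_proj_def)
  have mQ: "mat_size m m Q" "mat_mult N Q Q = Q"
    using Q mat_mult_size_cong[of N N Q m m Q] u(3) by (auto simp: mat_proj_def)
  define v where "v = mat_mult N u P"
  have v_eq: "v = mat_mult N Q u" by (simp add: v_def mat_mult_assoc flip: u(4,5))
  have v_size: "mat_size m n v" "mat_size N N v"
    using mat_size_mult[OF u(1) nP(1), of N] mat_size_mult[OF mQ(1) u(1), of N]
      mat_size_mult[OF u(1,2), of N]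
    by (auto simp: mat_size_def simp flip: v_def v_eq)
  have "mat_mult m (mat_star v) v = mat_mult N (mat_star v) v"
    by (rule mat_mult_size_cong[OF v_size])
  also have "\<dots> = mat_mult N P (mat_mult N (mat_mult N (mat_star u) u) P)"
    by (simp add: v_def mat_star_mult nP mat_mult_assoc)
  finally have vv: "mat_mult m (mat_star v) v = P" by (simp add: u nP)
  have "mat_mult n v (mat_star v) = mat_mult N v (mat_star v)"
    using v_size by (intro mat_mult_size_cong[of _ m _ _ N]) (simp_all add: mat_size_star)
  also have "\<dots> = mat_mult N (mat_mult N u (mat_mult N P P)) (mat_star u)"
    by (simp add: v_def mat_star_mult nP(2) mat_mult_assoc)
  also have "\<dots> = mat_mult N v (mat_star u)" by (simp add: nP v_def)
  also have "\<dots> = mat_mult N Q (mat_mult N u (mat_star u))" by (simp add: v_eq mat_mult_assoc)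
  finally have "mat_mult n v (mat_star v) = Q" by (simp add: u mQ)
  with vv v_size show ?thesis unfolding mat_equiv_def by blast
qed

lemma mvn_A_lift_iff:
  assumes P: "mat_proj n P" and Q: "mat_proj m Q"
  shows "mvn_A sc st (mat_lift P) (mat_lift Q) \<longleftrightarrow> mat_equiv n P m Q"
proof
  assume "mvn_A sc st (mat_lift P) (mat_lift Q)"
  then show "mat_equiv n P m Q"
    using mat_equiv_if_square[OF P Q] by (auto simp: mvn_A_def in_A_iff_lift lift_simps)
next
  assume "mat_equiv n P m Q"
  then obtain v where v: "mat_size m n v" "mat_mult m (mat_star v) v = P"
    "mat_mult n v (mat_star v) = Q"
    by (auto simp: mat_equiv_def)
  define N where "N = max m n"
  have vN: "mat_size N N v" using mat_size_mono[OF v(1)] by (simp add: N_def)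
  have "mat_mult N (mat_star v) v = P" using mat_mult_size_cong[OF vN v(1)] v(2) by simp
  moreover have "mat_mult N v (mat_star v) = Q"
    using mat_mult_size_cong[of N N "mat_star v" n m] vN v(1,3) by (simp add: mat_size_star)
  moreover have "mat_size N N P" "mat_size N N Q"
    using P Q by (auto simp: mat_proj_def N_def elim: mat_size_mono)
  ultimately show "mvn_A sc st (mat_lift P) (mat_lift Q)"
    unfolding mvn_A_def using vN
    by (intro exI[of _ N] exI[of _ "mat_lift v"]) (auto simp: in_A_iff_lift lift_simps)
qed

end

locale cancellative_cstar_algebra = cstar_algebra +
  assumes cancellation: "proj_A sc st n p \<Longrightarrow> proj_A sc st m q \<Longrightarrow>
    k0_eq sc st (n, p) (m, q) \<longleftrightarrow> mvn_A sc st p q"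
begin

lemma k0_eq_lift_iff:
  "mat_proj n P \<Longrightarrow> mat_proj m Q \<Longrightarrow>
    k0_eq sc st (n, mat_lift P) (m, mat_lift Q) \<longleftrightarrow> mat_equiv n P m Q"
  by (simp add: cancellation proj_A_lift mvn_A_lift_iff)

lemma k0_le_lift_iff:
  assumes "mat_proj n P" "mat_proj m Q"
  shows "k0_le sc st (n, mat_lift P) (m, mat_lift Q) \<longleftrightarrow> mat_subequiv n P m Q"
proof -
  have "k0_eq sc st (m, mat_lift Q) (k0_add (n, mat_lift P) (k, mat_lift E)) \<longleftrightarrow>
      mat_equiv m Q (n + k) (block_diag n n P E)" if "mat_proj k E" for k E
    using assms that by (simp add: k0_add_lift k0_eq_lift_iff mat_proj_block_diag)
  then show ?thesis unfolding k0_le_def mat_subequiv_def proj_A_iff by blast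
qed

lemma k0_eq_trans:
  assumes "x \<in> k0_cone" "y \<in> k0_cone" "z \<in> k0_cone" "k0_eq sc st x y" "k0_eq sc st y z"
  shows "k0_eq sc st x z"
  using assms by (auto simp: k0_cone_iff k0_eq_lift_iff intro: mat_equiv_trans)

lemma k0_le_cong:
  assumes "x \<in> k0_cone" "x' \<in> k0_cone" "y \<in> k0_cone" "k0_eq sc st x x'" "k0_le sc st x y"
  shows "k0_le sc st x' y"
  using assms by (auto simp: k0_cone_iff k0_eq_lift_iff k0_le_lift_iff intro: mat_subequiv_cong)

lemma k0_le_add_mono:
  assumes "x \<in> k0_cone" "x' \<in> k0_cone" "y \<in> k0_cone" "y' \<in> k0_cone"
    and "k0_le sc st x x'" "k0_le sc st y y'"
  shows "k0_le sc st (k0_add x y) (k0_add x' y')"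
  using assms by (auto
      simp: k0_cone_iff k0_add_lift k0_le_lift_iff mat_subequiv_block_diag mat_proj_block_diag)

lemma k0_le_single_0: "x \<in> k0_cone \<Longrightarrow> k0_le sc st (1, single 0) x"
  using k0_le_lift_iff[OF mat_proj_single[OF cproj_0]] mat_subequiv_0
  by (auto simp: k0_cone_iff single_lift)

section \<open>Singular values\<close>

lemma sval_le:
  "cproj st p \<Longrightarrow> k0_le sc st (1, single p) g \<Longrightarrow> sval sc st g a \<le> norm (a - a * p)"
  unfolding sval_def by (intro cInf_lower bdd_belowI[of _ 0]) auto

lemma sval_approx:
  assumes "g \<in> k0_cone" "\<epsilon> > 0"
  obtains p where "cproj st p" "k0_le sc st (1, single p) g"
    "norm (a - a * p) < sval sc st g a + \<epsilon>"
proof -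
  let ?S = "{norm (a - a * p) | p. cproj st p \<and> k0_le sc st (1, single p) g}"
  have "?S \<noteq> {}" using cproj_0 k0_le_single_0[OF assms(1)] by blast
  moreover have "Inf ?S < sval sc st g a + \<epsilon>" using assms(2) by (simp add: sval_def)
  ultimately obtain x where "x \<in> ?S" "x < sval sc st g a + \<epsilon>" using cInf_lessD[of ?S] by blast
  then show thesis using that by blast
qed

lemma k0_eq_add_singleE:
  assumes "cproj st p" "cproj st q" "cproj st f"
    and "k0_eq sc st (k0_add (1, single p) (1, single q)) (1, single f)"
  obtains x y where "st x * x = p" "st y * y = q" "st x * y = 0" "st y * x = 0"
    "f = x * st x + y * st y"
proof -
  have "mat_equiv (1 + 1) (block_diag 1 1 (mat_single p) (mat_single q)) 1 (mat_single f)"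
    using assms
    by (simp only: single_lift k0_add_lift k0_eq_lift_iff mat_proj_block_diag mat_proj_single)
  then obtain v where v: "mat_mult 1 (mat_star v) v = block_diag 1 1 (mat_single p) (mat_single q)"
    "mat_mult (1 + 1) v (mat_star v) = mat_single f"
    unfolding mat_equiv_def by blast
  have "st (v 0 i) * v 0 j = block_diag 1 1 (mat_single p) (mat_single q) i j" for i j
    using fun_cong[OF fun_cong[OF v(1), of i], of j] by (simp add: mat_mult_def mat_star_def)
  from this[of 0 0] this[of 1 1] this[of 0 1] this[of 1 0]
  have "st (v 0 0) * v 0 0 = p" "st (v 0 1) * v 0 1 = q"
    "st (v 0 0) * v 0 1 = 0" "st (v 0 1) * v 0 0 = 0"
    by (simp_all add: block_diag_def mat_single_def)
  moreover have "f = v 0 0 * st (v 0 0) + v 0 1 * st (v 0 1)"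
    using fun_cong[OF fun_cong[OF v(2), of 0], of 0]
    by (simp add: mat_mult_def mat_star_def mat_single_def)
  ultimately show thesis by (rule that)
qed

lemma factor_through_equiv_projection:
  assumes pq: "cproj st p" "cproj st q" and f: "cproj st f"
    and eq: "k0_eq sc st (k0_add (1, single p) (1, single q)) (1, single f)"
  obtains s t where "s * (f * t) = a * p + b * q"
proof -
  obtain x y where xy: "st x * x = p" "st y * y = q" "st x * y = 0" "st y * x = 0"
    and fxy: "f = x * st x + y * st y"
    using k0_eq_add_singleE[OF pq f eq] .
  have "f * (x + y) = x * p + y * q"
    by (simp add: fxy algebra_simps xy)
  then have "(a * st x + b * st y) * (f * (x + y)) =
      a * (st x * x) * p + b * (st y * y) * q + a * (st x * y) * q + b * (st y * x) * p"
    by (simp add: algebra_simps)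
  also have "\<dots> = a * p + b * q"
    using pq by (simp add: xy cproj_def mult.assoc)
  finally show thesis by (rule that)
qed

lemma approximating_projection:
  fixes a b :: 'a
  assumes clo: "in_closure_invertible_multipliers TYPE('a)"
    and p: "cproj st p" and q: "cproj st q" and f: "cproj st f"
    and eq: "k0_eq sc st (k0_add (1, single p) (1, single q)) (1, single f)" and "\<epsilon> > 0"
  obtains e where "cproj st e" "k0_eq sc st (1, single f) (1, single e)"
    "norm ((a + b) - (a + b) * e) \<le> norm (a - a * p) + norm (b - b * q) + \<epsilon>"
proof -
  obtain s t where sft: "s * (f * t) = a * p + b * q"
    using factor_through_equiv_projection[OF p q f eq] .
  define \<delta> where "\<delta> = \<epsilon> / (norm s + 1)"
  have \<delta>: "\<delta> > 0" "(norm s + 1) * \<delta> = \<epsilon>"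
    using \<open>\<epsilon> > 0\<close> add_nonneg_pos[OF norm_ge_zero[of s] zero_less_one] by (simp_all add: \<delta>_def)
  obtain v w where e: "cproj st (st v * v)" and v: "v * st v = f" "w * (st v * v) = w"
    and w: "norm (f * t - w) < \<delta>"
    using right_support_approx[OF clo f \<delta>(1)] .
  have "norm (s * (f * t - w)) \<le> (norm s + 1) * \<delta>"
    using w by (intro order_trans[OF norm_mult_ineq] mult_mono) auto
  then have error: "norm (s * (f * t - w)) \<le> \<epsilon>" by (simp add: \<delta>)
  have "norm ((a + b) - (a + b) * (st v * v)) \<le> norm ((a + b) - s * w)"
    using v(2) by (intro norm_minus_mult_cproj_le_dist[OF e]) (simp add: mult.assoc)
  also have "(a + b) - s * w = (a - a * p) + (b - b * q) + s * (f * t - w)"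
    by (simp add: right_diff_distrib sft)
  also have "norm \<dots> \<le> norm (a - a * p) + norm (b - b * q) + \<epsilon>"
    by (intro norm_triangle_mono order_refl error)
  finally have "norm ((a + b) - (a + b) * (st v * v)) \<le> norm (a - a * p) + norm (b - b * q) + \<epsilon>" .
  moreover have "k0_eq sc st (1, single f) (1, single (st v * v))"
    unfolding single_lift
    using k0_eq_lift_iff[OF mat_proj_single[OF f] mat_proj_single[OF e]]
      mat_equiv_sym[OF mat_equiv_single[of v]] by (simp only: v(1))
  ultimately show thesis using e by (intro that)
qed

lemma k0_le_add_singleI:
  assumes proj: "cproj st p" "cproj st q" "cproj st f" "cproj st e"
    and cone: "g \<in> k0_cone" "h \<in> k0_cone"
    and le: "k0_le sc st (1, single p) g" "k0_le sc st (1, single q) h"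
    and eq: "k0_eq sc st (k0_add (1, single p) (1, single q)) (1, single f)"
      "k0_eq sc st (1, single f) (1, single e)"
  shows "k0_le sc st (1, single e) (k0_add g h)"
proof (rule k0_le_cong)
  show "k0_eq sc st (k0_add (1, single p) (1, single q)) (1, single e)"
    by (rule k0_eq_trans[OF _ _ _ eq]) (intro k0_cone_add k0_cone_single proj)+
  show "k0_le sc st (k0_add (1, single p) (1, single q)) (k0_add g h)"
    by (intro k0_le_add_mono k0_cone_single proj cone le)
qed (intro k0_cone_add k0_cone_single proj cone)+

end

theorem theorem3p14:
  fixes sc :: "complex \<Rightarrow> 'a::{real_normed_algebra,banach} \<Rightarrow> 'a"
    and st :: "'a \<Rightarrow> 'a"
  assumes cstar: "cstar_algebra sc st"
    and cancellation: "\<And>n p m q. proj_A sc st n p \<Longrightarrow> proj_A sc st m q \<Longrightarrow>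
                          (k0_eq sc st (n, p) (m, q) \<longleftrightarrow> mvn_A sc st p q)"
    and closure: "in_closure_invertible_multipliers TYPE('a)"
    and K0plus_eq_D0: "\<And>n q. proj_A sc st n q \<Longrightarrow>
                          (\<exists>p. cproj st p \<and> k0_eq sc st (n, q) (1, single p))"
    and g: "proj_A sc st n q" and h: "proj_A sc st m r"
  shows "sval sc st (k0_add (n, q) (m, r)) (a + b) \<le> sval sc st (n, q) a + sval sc st (m, r) b"
proof (rule field_le_epsilon)
  interpret cancellative_cstar_algebra sc st
    by (intro cancellative_cstar_algebra.intro cancellative_cstar_algebra_axioms.intro
        cstar cancellation)
  fix \<epsilon> :: real assume "\<epsilon> > 0"
  then have third: "\<epsilon> / 3 > 0" by simp
  have cone: "(n, q) \<in> k0_cone" "(m, r) \<in> k0_cone" using g h by (simp_all add: k0_cone_def)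
  obtain p where p: "cproj st p" "k0_le sc st (1, single p) (n, q)"
    "norm (a - a * p) < sval sc st (n, q) a + \<epsilon> / 3"
    using sval_approx[OF cone(1) third] .
  obtain p' where p': "cproj st p'" "k0_le sc st (1, single p') (m, r)"
    "norm (b - b * p') < sval sc st (m, r) b + \<epsilon> / 3"
    using sval_approx[OF cone(2) third] .
  have "\<exists>f. cproj st f \<and> k0_eq sc st x (1, single f)" if "x \<in> k0_cone" for x
    using K0plus_eq_D0 that by (cases x) (simp add: k0_cone_def)
  then obtain f
    where f: "cproj st f" "k0_eq sc st (k0_add (1, single p) (1, single p')) (1, single f)"
    using k0_cone_add k0_cone_single p(1) p'(1) by meson
  obtain e where e: "cproj st e" "k0_eq sc st (1, single f) (1, single e)"
    "norm ((a + b) - (a + b) * e) \<le> norm (a - a * p) + norm (b - b * p') + \<epsilon> / 3"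
    using approximating_projection[OF closure p(1) p'(1) f third] .
  have "sval sc st (k0_add (n, q) (m, r)) (a + b) \<le> norm ((a + b) - (a + b) * e)"
    by (intro sval_le k0_le_add_singleI[OF p(1) p'(1) f(1) e(1) cone p(2) p'(2) f(2) e(2)] e)
  with p(3) p'(3) e(3)
  show "sval sc st (k0_add (n, q) (m, r)) (a + b) \<le> sval sc st (n, q) a + sval sc st (m, r) b + \<epsilon>"
    by linarith
qed

end
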